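(* Let $F$ be a field, let $n\geq 1$, let $\lambda\in F$ with $\lambda\neq 0$, and let $A\in F^{n\times n}$ be a cyclic matrix. Then $$\dim_F C_F(A,\lambda)=\deg\bigl(\gcd(c_A(t),c_{A,\lambda}(t))\bigr)=\deg\bigl(\gcd(c_{A,\lambda^{-1}}(t),c_A(t))\bigr).$$
   Context: For a field $F$, $A\in F^{n\times n}$ and $\lambda\in F$, the twisted centralizer code is the $F$-vector space $C_F(A,\lambda)=\{B\in F^{n\times n}\mid AB-\lambda BA=0\}$. The characteristic polynomial of $A$ is $c_A(t)=\det(tI-A)$. For $0\neq\lambda\in F$ the $\lambda$-twisted characteristic polynomial of $A\in F^{n\times n}$ is $c_{A,\lambda}(t):=\lambda^{-n}c_A(\lambda t)$; in particular $c_{A,\lambda^{-1}}(t)=\lambda^{n}c_A(\lambda^{-1}t)$. A matrix $A\in F^{n\times n}$ is cyclic if there is a row vector $v\in F^n$ such that $v,vA,\dots,vA^{n-1}$ is a basis of $F^n$ (equivalently, $c_A(t)$ equals the minimal polynomial of $A$). *)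

theory Defs
  imports
    "Jordan_Normal_Form.Char_Poly"
    "Jordan_Normal_Form.VS_Connect"
    "HOL-Computational_Algebra.Polynomial_Factorial"
begin

definition twisted_centralizer :: "'a :: field mat \<Rightarrow> 'a \<Rightarrow> 'a mat set" where
  "twisted_centralizer A l =
     {B \<in> carrier_mat (dim_row A) (dim_row A). A * B - l \<cdot>\<^sub>m (B * A) = 0\<^sub>m (dim_row A) (dim_row A)}"

text \<open>The same set as a vector space over the field: the space of square matrices with its
  carrier restricted.\<close>

definition twisted_centralizer_space :: "'a :: field mat \<Rightarrow> 'a \<Rightarrow> ('a, 'a mat) module" where
  "twisted_centralizer_space A l =
     (module_mat TYPE('a) (dim_row A) (dim_row A))\<lparr>carrier := twisted_centralizer A l\<rparr>"

definition twisted_char_poly :: "'a :: field mat \<Rightarrow> 'a \<Rightarrow> 'a poly" where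
  "twisted_char_poly A l = Polynomial.smult (inverse (l ^ dim_row A)) (char_poly A \<circ>\<^sub>p [:0, l:])"

text \<open>The library multiplies matrices with column vectors only; this is the row vector $vA$.\<close>

definition vec_mult_mat :: "'a :: semiring_0 vec \<Rightarrow> 'a mat \<Rightarrow> 'a vec" where
  "vec_mult_mat v A = vec (dim_col A) (\<lambda>j. v \<bullet> col A j)"

text \<open>The injectivity clause makes $v, vA, \ldots, vA^{n-1}$ a basis as a family and not only as
  a set.\<close>

definition cyclic_mat :: "'a :: field mat \<Rightarrow> bool" where
  "cyclic_mat A \<longleftrightarrow>
     (\<exists>v \<in> carrier_vec (dim_row A).
        inj_on (\<lambda>i. vec_mult_mat v (A ^\<^sub>m i)) {..<dim_row A} \<and>
        vectorspace.basis class_ring (module_vec TYPE('a) (dim_row A))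
          ((\<lambda>i. vec_mult_mat v (A ^\<^sub>m i)) ` {..<dim_row A}))"

text \<open>The library's \<^const>\<open>gcd\<close> on polynomials needs coefficients of class \<^class>\<open>field_gcd\<close>.
  For an arbitrary field we take the unique monic (or zero) greatest common divisor; the lemmas
  below show that it exists and that it is the library's \<^const>\<open>gcd\<close> wherever the latter
  is available.\<close>

definition is_normed_gcd :: "'a :: field poly \<Rightarrow> 'a poly \<Rightarrow> 'a poly \<Rightarrow> bool" where
  "is_normed_gcd p q d \<longleftrightarrow>
     d dvd p \<and> d dvd q \<and> (\<forall>e. e dvd p \<longrightarrow> e dvd q \<longrightarrow> e dvd d) \<and> (d = 0 \<or> lead_coeff d = 1)"

definition poly_gcd :: "'a :: field poly \<Rightarrow> 'a poly \<Rightarrow> 'a poly" where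
  "poly_gcd p q = (THE d. is_normed_gcd p q d)"

lemma is_normed_gcd_unique:
  assumes "is_normed_gcd p q d" "is_normed_gcd p q d'"
  shows "d = d'"
proof -
  have dd: "d dvd d'" "d' dvd d" using assms by (auto simp: is_normed_gcd_def)
  show ?thesis
  proof (cases "d = 0")
    case True
    then show ?thesis using dd by auto
  next
    case False
    then have "d' \<noteq> 0" using dd by auto
    then have "lead_coeff d = 1" "lead_coeff d' = 1"
      using False assms by (auto simp: is_normed_gcd_def)
    then show ?thesis using dd poly_dvd_antisym[of d d'] by simp
  qed
qed

lemma gcd_exists_field_poly:
  fixes p q :: "'a :: field poly"
  shows "\<exists>d. d dvd p \<and> d dvd q \<and> (\<forall>e. e dvd p \<longrightarrow> e dvd q \<longrightarrow> e dvd d)"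
proof (induction "euclidean_size q" arbitrary: p q rule: less_induct)
  case less
  show ?case
  proof (cases "q = 0")
    case True
    then show ?thesis by (intro exI[of _ p]) auto
  next
    case False
    then have "euclidean_size (p mod q) < euclidean_size q" by (rule mod_size_less)
    from less[OF this, of q] obtain d where
      d: "d dvd q" "d dvd p mod q" "\<And>e. e dvd q \<Longrightarrow> e dvd p mod q \<Longrightarrow> e dvd d" by blast
    then show ?thesis by (metis dvd_mod_iff)
  qed
qed

lemma is_normed_gcd_poly_gcd: "is_normed_gcd p q (poly_gcd p q)"
proof -
  obtain d where d: "d dvd p" "d dvd q" "\<And>e. e dvd p \<Longrightarrow> e dvd q \<Longrightarrow> e dvd d"
    using gcd_exists_field_poly by blast
  have "is_normed_gcd p q (Polynomial.smult (inverse (lead_coeff d)) d)"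
    using d by (cases "d = 0") (auto simp: is_normed_gcd_def smult_dvd_iff dvd_smult_iff)
  then show ?thesis
    unfolding poly_gcd_def by (metis is_normed_gcd_unique theI)
qed

lemma poly_gcd_eq_gcd: "poly_gcd p q = gcd p (q :: 'a :: field_gcd poly)"
proof -
  have "gcd p q = 0 \<or> lead_coeff (gcd p q) = 1"
  proof (cases "gcd p q = 0")
    case False
    have "unit_factor (gcd p q) = 1"
      using False by (simp add: unit_factor_gcd)
    then have "unit_factor (lead_coeff (gcd p q)) = 1"
      by (simp add: unit_factor_poly_def one_pCons)
    then show ?thesis by simp
  qed simp
  then have "is_normed_gcd p q (gcd p q)" by (auto simp: is_normed_gcd_def)
  then show ?thesis using is_normed_gcd_unique is_normed_gcd_poly_gcd by blast
qed

lemma mem_twisted_centralizer_iff: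
  assumes "A \<in> carrier_mat n n"
  shows "B \<in> twisted_centralizer A l \<longleftrightarrow> B \<in> carrier_mat n n \<and> A * B = l \<cdot>\<^sub>m (B * A)"
proof -
  have "X - Y = 0\<^sub>m n n \<longleftrightarrow> X = Y" if "X \<in> carrier_mat n n" "Y \<in> carrier_mat n n" for X Y :: "'a mat"
    using that by (auto simp: mat_eq_iff)
  moreover have "A * B \<in> carrier_mat n n" "l \<cdot>\<^sub>m (B * A) \<in> carrier_mat n n"
    if "B \<in> carrier_mat n n" using assms that by auto
  ultimately show ?thesis using assms by (auto simp: twisted_centralizer_def)
qed

lemma vectorspace_twisted_centralizer:
  fixes A :: "'a :: field mat"
  assumes A: "A \<in> carrier_mat n n"
  shows "vectorspace class_ring (twisted_centralizer_space A l)"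
proof -
  interpret V: vectorspace class_ring "module_mat TYPE('a) n n" by (rule matrix_vs)
  have "submodule class_ring (twisted_centralizer A l) (module_mat TYPE('a) n n)"
  proof (rule submodule.intro[OF V.module_axioms], unfold module_mat_simps class_ring_simps)
    show "twisted_centralizer A l \<subseteq> carrier_mat n n"
      using mem_twisted_centralizer_iff[OF A] by auto
    show "B + C \<in> twisted_centralizer A l"
      if "B \<in> twisted_centralizer A l" "C \<in> twisted_centralizer A l" for B C
    proof -
      have B: "B \<in> carrier_mat n n" "A * B = l \<cdot>\<^sub>m (B * A)"
        and C: "C \<in> carrier_mat n n" "A * C = l \<cdot>\<^sub>m (C * A)"
        using that mem_twisted_centralizer_iff[OF A] by auto
      have "A * (B + C) = l \<cdot>\<^sub>m (B * A) + l \<cdot>\<^sub>m (C * A)"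
        using A B C by (simp add: mult_add_distrib_mat)
      also have "\<dots> = l \<cdot>\<^sub>m ((B + C) * A)"
        using A B(1) C(1)
        by (simp add: add_mult_distrib_mat[of B n n] add_smult_distrib_left_mat[of "B * A" n n])
      finally show ?thesis using B(1) C(1) mem_twisted_centralizer_iff[OF A] by auto
    qed
    show "0\<^sub>m n n \<in> twisted_centralizer A l"
      using A by (auto simp: mem_twisted_centralizer_iff[OF A])
    show "c \<cdot>\<^sub>m B \<in> twisted_centralizer A l" if "B \<in> twisted_centralizer A l" for c B
    proof -
      have B: "B \<in> carrier_mat n n" "A * B = l \<cdot>\<^sub>m (B * A)"
        using that mem_twisted_centralizer_iff[OF A] by auto
      have "A * (c \<cdot>\<^sub>m B) = c \<cdot>\<^sub>m (l \<cdot>\<^sub>m (B * A))"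
        using A B by (simp add: mult_smult_distrib)
      also have "\<dots> = l \<cdot>\<^sub>m ((c \<cdot>\<^sub>m B) * A)"
        using A B(1) by (auto simp: mat_eq_iff)
      finally show ?thesis using B(1) mem_twisted_centralizer_iff[OF A] by auto
    qed
  qed
  then have "subspace class_ring (twisted_centralizer A l) (module_mat TYPE('a) n n)"
    by (intro subspace.intro matrix_vs)
  from V.subspace_is_vs[OF this] show ?thesis
    using A by (simp add: twisted_centralizer_space_def)
qed

end

theory Submission
  imports Defs
begin

text \<open>Let $v$ be a cyclic row vector for $A$ and $c = c_A$. By the Cayley-Hamilton theorem and since
  $\deg c = n$, the map $q \mapsto v\,q(A)$ identifies $F[t]/(c)$ with $F^n$.

  If $AB = \lambda BA$, then $q(A)B = B\,q(\lambda A)$ for every polynomial $q$. Hence $B$ sends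
  $v\,q(A)$ to $w\,q(\lambda A)$, where $w = vB$, and so $B$ is determined by $w$
  (\<open>twisted_centralizer_eqI\<close>). Such a $B$ exists for a given $w$ exactly if the assignment
  $v\,q(A) \mapsto w\,q(\lambda A)$ is well defined, that is, if $w\,c(\lambda A) = 0$
  (\<open>twisted_centralizer_imp_dvd\<close>, \<open>ex_twisted_centralizer\<close>). For $w = v\,q(A)$ this means
  that $c(t)$ divides $q(t)\,c(\lambda t)$, equivalently $q(t)\,g(t)$ for
  $g = \gcd(c(t), c(\lambda t))$, equivalently that $h = c/g$ divides $q$.
  The twisted centralizer is therefore isomorphic to $hF[t]/(c)$, that is to $F[t]/(g)$, a space of
  dimension $\deg g$ (\<open>dim_twisted_centralizer\<close>).

  The second equality holds because the substitution $t \mapsto \lambda t$ is an automorphism of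
  $F[t]$ that preserves degrees and turns the pair $c(\lambda^{-1}t), c(t)$ into
  $c(t), c(\lambda t)$; scaling the polynomials by units does not affect their gcd.\<close>

section \<open>Polynomials evaluated at a matrix\<close>

text \<open>Horner's scheme, because its recursion fits induction over \<^const>\<open>pCons\<close>.\<close>

definition mat_eval :: "'a :: comm_ring_1 mat \<Rightarrow> 'a poly \<Rightarrow> 'a mat" where
  "mat_eval A p =
     fold_coeffs (\<lambda>a X. a \<cdot>\<^sub>m 1\<^sub>m (dim_row A) + X * A) p (0\<^sub>m (dim_row A) (dim_row A))"

lemma mat_eval_0: "A \<in> carrier_mat n n \<Longrightarrow> mat_eval A 0 = 0\<^sub>m n n"
  by (auto simp: mat_eval_def)

lemma mat_eval_pCons:
  assumes A: "A \<in> carrier_mat n n"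
  shows "mat_eval A (pCons a p) = a \<cdot>\<^sub>m 1\<^sub>m n + mat_eval A p * A"
proof (cases "a = 0 \<and> p = 0")
  case True
  then show ?thesis using A by (auto simp: mat_eval_def)
next
  case False
  then have "fold_coeffs f (pCons a p) z = f a (fold_coeffs f p z)"
    for f :: "'a \<Rightarrow> 'a mat \<Rightarrow> 'a mat" and z by (cases "p = 0") auto
  then show ?thesis using A by (simp add: mat_eval_def)
qed

lemma mat_eval_carrier:
  assumes A: "A \<in> carrier_mat n n"
  shows "mat_eval A p \<in> carrier_mat n n"
  by (induction p) (use A in \<open>auto simp: mat_eval_0 mat_eval_pCons\<close>)

lemma mat_eval_dim:
  assumes A: "A \<in> carrier_mat n n"
  shows "dim_row (mat_eval A p) = n" "dim_col (mat_eval A p) = n"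
  using mat_eval_carrier[OF A] by auto

lemma mat_eval_const:
  assumes A: "A \<in> carrier_mat n n"
  shows "mat_eval A [:a:] = a \<cdot>\<^sub>m 1\<^sub>m n"
  using A by (simp add: mat_eval_pCons mat_eval_0)

lemma mat_eval_add:
  assumes A: "A \<in> carrier_mat n n"
  shows "mat_eval A (p + q) = mat_eval A p + mat_eval A q"
proof (induction p arbitrary: q)
  case 0
  then show ?case using A left_add_zero_mat[OF mat_eval_carrier[OF A, of q]]
    by (simp add: mat_eval_0)
next
  case (pCons a p)
  obtain b r where q: "q = pCons b r" by (cases q)
  have "(mat_eval A p + mat_eval A r) * A = mat_eval A p * A + mat_eval A r * A"
    using A by (intro add_mult_distrib_mat[of _ n n] mat_eval_carrier) auto
  then show ?case unfolding q add_pCons mat_eval_pCons[OF A] pCons.IH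
    using A by (auto simp: mat_eq_iff mat_eval_dim[OF A] algebra_simps)
qed

lemma mat_eval_smult:
  assumes A: "A \<in> carrier_mat n n"
  shows "mat_eval A (Polynomial.smult c p) = c \<cdot>\<^sub>m mat_eval A p"
proof (induction p)
  case 0
  then show ?case using A by (simp add: mat_eval_0)
next
  case (pCons a p)
  have "(c \<cdot>\<^sub>m mat_eval A p) * A = c \<cdot>\<^sub>m (mat_eval A p * A)"
    using A by (intro mult_smult_assoc_mat[of _ n n] mat_eval_carrier) auto
  then show ?case unfolding smult_pCons mat_eval_pCons[OF A] pCons.IH
    using A by (auto simp: mat_eq_iff mat_eval_dim[OF A] algebra_simps)
qed

lemma mat_eval_mult:
  assumes A: "A \<in> carrier_mat n n"
  shows "mat_eval A (p * q) = mat_eval A q * mat_eval A p"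
proof (induction p)
  case 0
  then show ?case
    using A right_mult_zero_mat[OF mat_eval_carrier[OF A, of q]] by (simp add: mat_eval_0)
next
  case (pCons a p)
  note car = mat_eval_carrier[OF A, of p] mat_eval_carrier[OF A, of q]
  have "mat_eval A (pCons a p * q) = a \<cdot>\<^sub>m mat_eval A q + mat_eval A q * mat_eval A p * A"
    using A car unfolding mult_pCons_left mat_eval_add[OF A] mat_eval_smult[OF A] mat_eval_pCons[OF A]
      pCons.IH by (auto simp: mat_eq_iff mat_eval_dim[OF A])
  also have "\<dots> = mat_eval A q * (a \<cdot>\<^sub>m 1\<^sub>m n + mat_eval A p * A)"
    using A car by (simp add: mult_add_distrib_mat[of _ n n _ n] mult_smult_distrib[of _ n n _ n]
        assoc_mult_mat[of _ n n _ n _ n])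
  finally show ?case by (simp add: mat_eval_pCons[OF A])
qed

lemma mat_eval_sum_index:
  assumes A: "A \<in> carrier_mat n n" and ij: "i < n" "j < n"
  shows "mat_eval A (sum f S) $$ (i, j) = (\<Sum>x\<in>S. mat_eval A (f x) $$ (i, j))"
proof (induction S rule: infinite_finite_induct)
  case (insert x S)
  then show ?case
    using ij mat_eval_carrier[OF A, of "f x"] mat_eval_carrier[OF A, of "sum f S"]
    by (simp add: mat_eval_add[OF A])
qed (use A ij in \<open>simp_all add: mat_eval_0\<close>)

lemma mat_eval_index:
  assumes A: "A \<in> carrier_mat n n" and ij: "i < n" "j < n" and "\<forall>k\<ge>N. coeff p k = 0"
  shows "mat_eval A p $$ (i, j) = (\<Sum>k<N. coeff p k * (A ^\<^sub>m k) $$ (i, j))"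
  using assms(4) ij
proof (induction N arbitrary: p i j)
  case 0
  then have "p = 0" by (simp add: poly_eq_iff)
  then show ?case using A 0 by (simp add: mat_eval_0)
next
  case (Suc N)
  obtain a q where p: "p = pCons a q" by (cases p)
  have q: "\<forall>k\<ge>N. coeff q k = 0"
    using Suc.prems(1) unfolding p by (metis Suc_le_mono coeff_pCons_Suc)
  have car: "mat_eval A q \<in> carrier_mat n n" "\<And>k. A ^\<^sub>m k \<in> carrier_mat n n"
    using A by (auto simp: mat_eval_carrier)
  have "(mat_eval A q * A) $$ (i, j) = (\<Sum>m<n. mat_eval A q $$ (i, m) * A $$ (m, j))"
    using A Suc.prems by (simp add: mat_eval_dim[OF A] scalar_prod_def lessThan_atLeast0)
  also have "\<dots> = (\<Sum>m<n. \<Sum>k<N. coeff q k * ((A ^\<^sub>m k) $$ (i, m) * A $$ (m, j)))"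
    using Suc.IH[OF q] Suc.prems by (intro sum.cong) (auto simp: sum_distrib_right mult.assoc)
  also have "\<dots> = (\<Sum>k<N. coeff q k * (\<Sum>m<n. (A ^\<^sub>m k) $$ (i, m) * A $$ (m, j)))"
    by (subst sum.swap) (simp add: sum_distrib_left)
  also have "\<dots> = (\<Sum>k<N. coeff q k * (A ^\<^sub>m Suc k) $$ (i, j))"
    using A car Suc.prems by (intro sum.cong) (auto simp: scalar_prod_def lessThan_atLeast0)
  finally have *: "(mat_eval A q * A) $$ (i, j) = (\<Sum>k<N. coeff q k * (A ^\<^sub>m Suc k) $$ (i, j))" .
  have "mat_eval A p $$ (i, j) = a * (1\<^sub>m n) $$ (i, j) + (mat_eval A q * A) $$ (i, j)"
    using A car Suc.prems(2,3) by (simp add: p mat_eval_pCons)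
  then show ?case unfolding * using A
    by (simp add: p sum.lessThan_Suc_shift del: sum.lessThan_Suc pow_mat.simps(2))
qed

text \<open>Substitution $t \mapsto \lambda t$ is what moving $B$ to the left across a polynomial in $A$
  costs: each factor $A$ that is passed contributes one $\lambda$.\<close>

lemma mat_eval_intertwine:
  assumes A: "A \<in> carrier_mat n n" and B: "B \<in> carrier_mat n n"
    and AB: "A * B = l \<cdot>\<^sub>m (B * A)"
  shows "mat_eval A p * B = B * mat_eval A (p \<circ>\<^sub>p [:0, l:])"
proof (induction p)
  case 0
  then show ?case using A B by (simp add: mat_eval_0)
next
  case (pCons a p)
  define q where "q = p \<circ>\<^sub>p [:0, l:]"
  note car = mat_eval_carrier[OF A, of p] mat_eval_carrier[OF A, of q]
  have "(a \<cdot>\<^sub>m 1\<^sub>m n + mat_eval A p * A) * B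
      = a \<cdot>\<^sub>m 1\<^sub>m n * B + mat_eval A p * A * B"
    using A B car by (intro add_mult_distrib_mat[of _ n n] mult_carrier_mat[of _ n n]) auto
  then have "mat_eval A (pCons a p) * B = a \<cdot>\<^sub>m B + mat_eval A p * (A * B)"
    using A B car
    by (simp add: mat_eval_pCons mult_smult_assoc_mat[of _ n n] assoc_mult_mat[of _ n n _ n _ n])
  also have "mat_eval A p * (A * B) = l \<cdot>\<^sub>m (mat_eval A p * B * A)"
    using A B car by (simp add: AB mult_smult_distrib[of _ n n _ n] assoc_mult_mat[of _ n n _ n _ n])
  also have "\<dots> = l \<cdot>\<^sub>m (B * mat_eval A q * A)" by (simp add: pCons.IH q_def)
  also have "a \<cdot>\<^sub>m B + \<dots> = B * (a \<cdot>\<^sub>m 1\<^sub>m n + (l \<cdot>\<^sub>m mat_eval A q) * A)"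
    using A B car by (simp add: mult_add_distrib_mat[of _ n n _ n] mult_smult_distrib[of _ n n _ n]
        mult_smult_assoc_mat[of _ n n] assoc_mult_mat[of _ n n _ n _ n])
  also have "\<dots> = B * mat_eval A (pCons a p \<circ>\<^sub>p [:0, l:])"
  proof -
    have "pCons a p \<circ>\<^sub>p [:0, l:] = pCons a (Polynomial.smult l q)"
      by (simp add: pcompose_pCons q_def)
    then show ?thesis by (simp add: mat_eval_pCons[OF A] mat_eval_smult[OF A])
  qed
  finally show ?case .
qed

section \<open>The Cayley-Hamilton theorem\<close>

text \<open>Let $X = tI - A$ and let $Y$ be its adjugate, so that $YX = c_A(t) I$. Evaluating the entries
  of $X$ at $A$ gives a matrix of matrices, and $\sum_i e_i X_{ki}(A) = e_k A - e_k A = 0$ for the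
  unit row vectors $e_i$. Multiplying by $Y_{lk}(A)$ and summing over $k$ yields $e_l\,c_A(A) = 0$.\<close>

theorem cayley_hamilton:
  assumes A: "A \<in> carrier_mat n n"
  shows "mat_eval A (char_poly A) = 0\<^sub>m n n"
proof (rule eq_matI)
  fix l j assume "l < dim_row (0\<^sub>m n n :: 'a mat)" "j < dim_col (0\<^sub>m n n :: 'a mat)"
  then have lj: "l < n" "j < n" by auto
  define X where "X = char_poly_matrix A"
  define Y where "Y = adj_mat X"
  have X: "X \<in> carrier_mat n n" using A by (simp add: X_def)
  have Y: "Y \<in> carrier_mat n n" and YX: "Y * X = char_poly A \<cdot>\<^sub>m 1\<^sub>m n"
    using adj_mat[OF X] by (auto simp: Y_def X_def char_poly_def)
  have ev: "mat_eval A p \<in> carrier_mat n n" for p using A by (rule mat_eval_carrier)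
  have Xk: "mat_eval A (X $$ (k, i)) $$ (i, m) = (if i = k then A $$ (k, m) else 0) - (if i = m then A $$ (k, m) else 0)"
    if "k < n" "i < n" "m < n" for k i m
    using that A by (auto simp: X_def char_poly_matrix_def mat_eval_pCons mat_eval_0 mat_eval_dim one_pCons)
  \<comment> \<open>Entry $m$ of $\sum_i e_i X_{ki}(A)$.\<close>
  have zero: "(\<Sum>i<n. mat_eval A (X $$ (k, i)) $$ (i, m)) = 0" if "k < n" "m < n" for k m
  proof -
    have "(\<Sum>i<n. mat_eval A (X $$ (k, i)) $$ (i, m))
        = (\<Sum>i<n. (if i = k then A $$ (k, m) else 0) - (if i = m then A $$ (k, m) else 0))"
      using that by (intro sum.cong) (auto simp: Xk)
    then show ?thesis using that by (simp add: sum_subtractf)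
  qed
  have "mat_eval A (char_poly A) $$ (l, j)
      = (\<Sum>i<n. if i = l then mat_eval A (char_poly A) $$ (i, j) else 0)"
    using lj by simp
  also have "\<dots> = (\<Sum>i<n. mat_eval A ((Y * X) $$ (l, i)) $$ (i, j))"
    using lj A by (intro sum.cong) (auto simp: YX mat_eval_0)
  also have "\<dots> = (\<Sum>i<n. \<Sum>k<n. mat_eval A (Y $$ (l, k) * X $$ (k, i)) $$ (i, j))"
    using lj X Y
    by (intro sum.cong) (auto simp: scalar_prod_def lessThan_atLeast0 mat_eval_sum_index[OF A])
  also have "\<dots> = (\<Sum>i<n. \<Sum>k<n. \<Sum>m<n.
      mat_eval A (X $$ (k, i)) $$ (i, m) * mat_eval A (Y $$ (l, k)) $$ (m, j))"
  proof (intro sum.cong refl)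
    fix i k assume "i \<in> {..<n}" "k \<in> {..<n}"
    then show "mat_eval A (Y $$ (l, k) * X $$ (k, i)) $$ (i, j) = (\<Sum>m<n.
      mat_eval A (X $$ (k, i)) $$ (i, m) * mat_eval A (Y $$ (l, k)) $$ (m, j))"
      using lj ev[of "X $$ (k, i)"] ev[of "Y $$ (l, k)"]
      by (simp add: mat_eval_mult[OF A] scalar_prod_def lessThan_atLeast0)
  qed
  also have "\<dots> = (\<Sum>k<n. \<Sum>m<n. \<Sum>i<n.
      mat_eval A (X $$ (k, i)) $$ (i, m) * mat_eval A (Y $$ (l, k)) $$ (m, j))"
    by (subst sum.swap) (intro sum.cong refl sum.swap)
  also have "\<dots> = 0"
    by (simp add: sum_distrib_right[symmetric] zero)
  finally show "mat_eval A (char_poly A) $$ (l, j) = 0\<^sub>m n n $$ (l, j)" using lj by simp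
qed (use mat_eval_carrier[OF A] in auto)

section \<open>Row vectors times matrices\<close>

lemma vec_mult_mat_carrier:
  "M \<in> carrier_mat n m \<Longrightarrow> vec_mult_mat v M \<in> carrier_vec m"
  by (simp add: vec_mult_mat_def)

lemma vec_mult_mat_conv_transpose:
  fixes M :: "'a :: comm_ring_1 mat"
  assumes "M \<in> carrier_mat n m" "v \<in> carrier_vec n"
  shows "vec_mult_mat v M = transpose_mat M *\<^sub>v v"
  using assms by (auto simp: vec_mult_mat_def comm_scalar_prod[of _ n])

lemma vec_mult_mat_assoc:
  fixes M :: "'a :: comm_ring_1 mat"
  assumes M: "M \<in> carrier_mat n m" and N: "N \<in> carrier_mat m k" and v: "v \<in> carrier_vec n"
  shows "vec_mult_mat v (M * N) = vec_mult_mat (vec_mult_mat v M) N"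
proof -
  have "transpose_mat N * transpose_mat M *\<^sub>v v = transpose_mat N *\<^sub>v (transpose_mat M *\<^sub>v v)"
    using M N v by (intro assoc_mult_mat_vec[of _ k m _ n]) auto
  then show ?thesis
    using vec_mult_mat_conv_transpose[OF mult_carrier_mat[OF M N] v]
      vec_mult_mat_conv_transpose[OF M v]
      vec_mult_mat_conv_transpose[OF N vec_mult_mat_carrier[OF M, of v]]
    by (simp add: transpose_mult[OF M N])
qed

lemma vec_mult_mat_index:
  assumes "M \<in> carrier_mat n m" "v \<in> carrier_vec n" "j < m"
  shows "vec_mult_mat v M $ j = (\<Sum>i<n. v $ i * M $$ (i, j))"
  using assms by (auto simp: vec_mult_mat_def scalar_prod_def lessThan_atLeast0)

lemma vec_mult_mat_add:
  fixes M :: "'a :: comm_ring_1 mat"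
  assumes "M \<in> carrier_mat n m" "N \<in> carrier_mat n m" "v \<in> carrier_vec n"
  shows "vec_mult_mat v (M + N) = vec_mult_mat v M + vec_mult_mat v N"
  using assms by (auto simp: vec_mult_mat_def scalar_prod_add_distrib[of _ n] col_add[of _ n m])

lemma vec_mult_mat_smult:
  fixes M :: "'a :: comm_ring_1 mat"
  assumes "M \<in> carrier_mat n m" "v \<in> carrier_vec n"
  shows "vec_mult_mat v (c \<cdot>\<^sub>m M) = c \<cdot>\<^sub>v vec_mult_mat v M"
  using assms by (auto simp: vec_mult_mat_def)

lemma vec_mult_mat_unit_vec:
  fixes M :: "'a :: comm_ring_1 mat"
  assumes "M \<in> carrier_mat n m" "i < n"
  shows "vec_mult_mat (unit_vec n i) M = row M i"
  using assms by (auto simp: vec_mult_mat_def)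

lemma mat_eq_by_vec_mult_mat:
  fixes M N :: "'a :: comm_ring_1 mat"
  assumes M: "M \<in> carrier_mat n m" and N: "N \<in> carrier_mat n m"
    and eq: "\<And>v. v \<in> carrier_vec n \<Longrightarrow> vec_mult_mat v M = vec_mult_mat v N"
  shows "M = N"
proof (rule eq_rowI)
  show "row M i = row N i" if "i < dim_row N" for i
    using that eq[of "unit_vec n i"] vec_mult_mat_unit_vec[OF M] vec_mult_mat_unit_vec[OF N] N
    by auto
qed (use M N in auto)

text \<open>Cyclicity in terms of polynomials: linear independence of $v, vA, \ldots, vA^{n-1}$ says that
  no nonzero polynomial of degree below $n$ annihilates $v$, and spanning says that $v$ generates
  $F^n$ as an $F[t]$-module. The condition on the degree is phrased by vanishing coefficients, so
  that for $n = 0$ it describes the zero polynomial.\<close>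

lemma cyclic_matE:
  fixes A :: "'a :: field mat"
  assumes A: "A \<in> carrier_mat n n" and cyc: "cyclic_mat A"
  obtains v where "v \<in> carrier_vec n"
    and "\<And>q. \<forall>k\<ge>n. coeff q k = 0 \<Longrightarrow> vec_mult_mat v (mat_eval A q) = 0\<^sub>v n \<Longrightarrow> q = 0"
    and "\<And>w. w \<in> carrier_vec n \<Longrightarrow> \<exists>q. vec_mult_mat v (mat_eval A q) = w"
proof -
  interpret vec_space "TYPE('a)" n .
  obtain v where v: "v \<in> carrier_vec n"
    and inj: "inj_on (\<lambda>i. vec_mult_mat v (A ^\<^sub>m i)) {..<n}"
    and basis: "basis ((\<lambda>i. vec_mult_mat v (A ^\<^sub>m i)) ` {..<n})"
    using cyc A unfolding cyclic_mat_def by auto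
  define f where "f = (\<lambda>i. vec_mult_mat v (A ^\<^sub>m i))"
  define S where "S = f ` {..<n}"
  have inj: "inj_on f {..<n}" using inj by (simp add: f_def)
  have S: "finite S" "S \<subseteq> carrier_vec n" "lin_indpt S" "span S = carrier_vec n"
    using basis A by (auto simp: basis_def S_def f_def)
  have lincomb: "lincomb a S $ j = (\<Sum>k<n. a (f k) * f k $ j)" if "j < n" for a j
    using that S inj by (simp add: lincomb_index S_def sum.reindex)
  have eval: "vec_mult_mat v (mat_eval A q) $ j = (\<Sum>k<n. coeff q k * f k $ j)"
    if q: "\<forall>k\<ge>n. coeff q k = 0" and j: "j < n" for q j
  proof -
    have "vec_mult_mat v (mat_eval A q) $ j
        = (\<Sum>i<n. \<Sum>k<n. coeff q k * (v $ i * (A ^\<^sub>m k) $$ (i, j)))"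
      using j
      by (simp add: vec_mult_mat_index[OF mat_eval_carrier[OF A] v] mat_eval_index[OF A _ _ q]
          sum_distrib_left mult.left_commute)
    also have "\<dots> = (\<Sum>k<n. coeff q k * f k $ j)"
      using v A j by (subst sum.swap) (simp add: f_def vec_mult_mat_index[of _ n n] sum_distrib_left)
    finally show ?thesis .
  qed
  show thesis
  proof
    show "v \<in> carrier_vec n" by fact
  next
    fix q assume q: "\<forall>k\<ge>n. coeff q k = 0" "vec_mult_mat v (mat_eval A q) = 0\<^sub>v n"
    \<comment> \<open>The coefficient family has to be indexed by the vectors of the basis themselves, not by
      their positions.\<close>
    define a where "a = (\<lambda>x. coeff q (the_inv_into {..<n} f x))"
    have a: "a (f k) = coeff q k" if "k < n" for k
      using that inj by (simp add: a_def the_inv_into_f_f)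
    have "lincomb a S = 0\<^sub>v n"
    proof (rule eq_vecI)
      show "lincomb a S $ j = 0\<^sub>v n $ j" if "j < dim_vec (0\<^sub>v n :: 'a vec)" for j
        using that eval[OF q(1), of j] by (simp add: lincomb a q(2))
    qed (use S in auto)
    then have "a x = 0" if "x \<in> S" for x
      using S(1,3) that unfolding lin_dep_def by blast
    then have "coeff q k = 0" if "k < n" for k using that a by (auto simp: S_def)
    then show "q = 0" using q(1) by (metis leI leading_coeff_0_iff)
  next
    fix w :: "'a vec" assume w_car: "w \<in> carrier_vec n"
    then have "w \<in> span S" using S(4) by simp
    then obtain a where w: "w = lincomb a S"
      unfolding finite_span[OF S(1,2)] by blast
    define q where "q = (\<Sum>k<n. Polynomial.monom (a (f k)) k)"
    have q: "coeff q k = (if k < n then a (f k) else 0)" for k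
      by (auto simp: q_def coeff_sum)
    have "vec_mult_mat v (mat_eval A q) = w"
    proof (rule eq_vecI)
      show "vec_mult_mat v (mat_eval A q) $ j = w $ j" if "j < dim_vec w" for j
        using that w_car eval[of q j] by (simp add: q lincomb flip: w) (simp add: w lincomb)
    qed (use w_car in \<open>simp add: vec_mult_mat_def mat_eval_dim[OF A]\<close>)
    then show "\<exists>q. vec_mult_mat v (mat_eval A q) = w" by blast
  qed
qed


section \<open>Greatest common divisors over an arbitrary field\<close>

lemma poly_bezout:
  fixes p q :: "'a :: field poly"
  shows "\<exists>s t. s * p + t * q dvd p \<and> s * p + t * q dvd q"
proof (induction "euclidean_size q" arbitrary: p q rule: less_induct)
  case less
  show ?case
  proof (cases "q = 0")
    case True
    then show ?thesis by (intro exI[of _ 1] exI[of _ 0]) auto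
  next
    case False
    then have "euclidean_size (p mod q) < euclidean_size q" by (rule mod_size_less)
    from less[OF this, of q] obtain s t where
      st: "s * q + t * (p mod q) dvd q" "s * q + t * (p mod q) dvd p mod q" by blast
    have "s * q + t * (p mod q) = t * p + (s - t * (p div q)) * q"
      by (simp add: minus_div_mult_eq_mod[symmetric] algebra_simps)
    then show ?thesis using st by (metis dvd_mod_iff)
  qed
qed

text \<open>By Bezout's identity the gcd is $(sp + tf)m$ for some polynomials $s, t, m$, hence congruent
  to a multiple of $f$ modulo $p$; conversely, $f$ is a multiple of the gcd.\<close>

lemma dvd_mult_iff_dvd_mult_poly_gcd:
  fixes p q f :: "'a :: field poly"
  shows "p dvd q * f \<longleftrightarrow> p dvd q * poly_gcd p f"
proof
  obtain s t where st: "s * p + t * f dvd p" "s * p + t * f dvd f" using poly_bezout by blast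
  have gcd: "poly_gcd p f dvd f" "s * p + t * f dvd poly_gcd p f"
    using is_normed_gcd_poly_gcd[of p f] st by (auto simp: is_normed_gcd_def)
  obtain m where m: "poly_gcd p f = (s * p + t * f) * m" using gcd(2) by (elim dvdE)
  show "p dvd q * poly_gcd p f" if "p dvd q * f"
  proof -
    have "q * poly_gcd p f = p * (q * s * m) + q * f * (t * m)"
      unfolding m by (simp add: algebra_simps)
    then show ?thesis using that by simp
  qed
  show "p dvd q * f" if "p dvd q * poly_gcd p f"
    using that gcd(1) by (meson dvd_refl dvd_trans mult_dvd_mono)
qed

section \<open>The module generated by a cyclic vector\<close>

locale cyclic_vector =
  fixes A :: "'a :: field mat" and n :: nat and v :: "'a vec"
  assumes A: "A \<in> carrier_mat n n"
    and v: "v \<in> carrier_vec n"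
    and indep: "\<forall>k\<ge>n. coeff q k = 0 \<Longrightarrow> vec_mult_mat v (mat_eval A q) = 0\<^sub>v n \<Longrightarrow> q = 0"
    and gen: "w \<in> carrier_vec n \<Longrightarrow> \<exists>q. vec_mult_mat v (mat_eval A q) = w"
begin

text \<open>The $F[t]$-module homomorphism $F[t] \to F^n$ sending $1$ to $v$.\<close>

definition act :: "'a poly \<Rightarrow> 'a vec" where
  "act q = vec_mult_mat v (mat_eval A q)"

abbreviation c :: "'a poly" where "c \<equiv> char_poly A"

lemma act_carrier [simp]: "act q \<in> carrier_vec n"
  by (simp add: act_def vec_mult_mat_carrier[OF mat_eval_carrier[OF A]])

lemma act_dim [simp]: "dim_vec (act q) = n"
  using act_carrier[of q] by (simp del: act_carrier)

lemma surj_act: "w \<in> carrier_vec n \<Longrightarrow> \<exists>q. act q = w"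
  using gen by (simp add: act_def)

lemma act_add: "act (p + q) = act p + act q"
  unfolding act_def mat_eval_add[OF A]
  by (rule vec_mult_mat_add[OF mat_eval_carrier[OF A] mat_eval_carrier[OF A] v])

lemma act_smult: "act (Polynomial.smult a p) = a \<cdot>\<^sub>v act p"
  unfolding act_def mat_eval_smult[OF A]
  by (rule vec_mult_mat_smult[OF mat_eval_carrier[OF A] v])

lemma act_0: "act 0 = 0\<^sub>v n"
  using act_smult[of 0 0] by (auto simp: vec_eq_iff)

lemma act_1: "act 1 = v"
  using v by (auto simp: act_def one_pCons mat_eval_const[OF A] vec_mult_mat_def)

lemma act_mult: "act (p * q) = vec_mult_mat (act q) (mat_eval A p)"
  unfolding act_def mat_eval_mult[OF A]
  by (rule vec_mult_mat_assoc[OF mat_eval_carrier[OF A] mat_eval_carrier[OF A] v])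

lemma act_X_mult: "act ([:0, 1:] * q) = vec_mult_mat (act q) A"
proof -
  have "mat_eval A [:0, 1:] = A" using A by (auto simp: mat_eval_pCons mat_eval_0)
  then show ?thesis by (simp only: act_mult)
qed

lemma act_sum_index: "j < n \<Longrightarrow> act (sum f S) $ j = (\<Sum>x\<in>S. act (f x) $ j)"
  by (induction S rule: infinite_finite_induct) (auto simp: act_0 act_add)

text \<open>The annihilator of $v$ is generated by $c_A$: Cayley-Hamilton puts $c_A$ into it, and the
  remainder of an annihilating polynomial modulo $c_A$ has degree below $n$, so it vanishes by
  cyclicity.\<close>

lemma act_eq_0_iff: "act q = 0\<^sub>v n \<longleftrightarrow> c dvd q"
proof
  have n: "degree c = n" and c: "c \<noteq> 0"
    using degree_monic_char_poly[OF A] by auto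
  have multiple: "act (c * k) = 0\<^sub>v n" for k
    using v by (auto simp: act_def mat_eval_mult[OF A] cayley_hamilton[OF A] vec_mult_mat_def
        right_mult_zero_mat[OF mat_eval_carrier[OF A]])
  show "act q = 0\<^sub>v n" if "c dvd q"
    using that multiple by (auto elim: dvdE)
  assume q: "act q = 0\<^sub>v n"
  have "act q = act (c * (q div c)) + act (q mod c)" by (simp flip: act_add)
  then have "act (q mod c) = 0\<^sub>v n" by (simp add: q multiple)
  moreover have "\<forall>k\<ge>n. coeff (q mod c) k = 0"
    using degree_mod_less[OF c, of q] n by (auto intro: coeff_eq_0)
  ultimately show "c dvd q" using indep by (auto simp: act_def)
qed

lemma act_eq_iff: "act p = act q \<longleftrightarrow> c dvd p - q"
proof -
  have "act p = act (p - q) + act q" by (simp flip: act_add)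
  then have "act p = act q \<longleftrightarrow> act (p - q) = 0\<^sub>v n" by (auto simp: vec_eq_iff)
  then show ?thesis by (simp add: act_eq_0_iff)
qed

section \<open>The twisted centralizer of a cyclic matrix\<close>

lemma act_intertwine:
  assumes B: "B \<in> twisted_centralizer A l" and vB: "vec_mult_mat v B = act q"
  shows "vec_mult_mat (act p) B = act ((p \<circ>\<^sub>p [:0, l:]) * q)"
proof -
  have B: "B \<in> carrier_mat n n" "A * B = l \<cdot>\<^sub>m (B * A)"
    using B mem_twisted_centralizer_iff[OF A] by auto
  note ev = mat_eval_carrier[OF A]
  have "vec_mult_mat (act p) B = vec_mult_mat v (mat_eval A p * B)"
    unfolding act_def by (rule vec_mult_mat_assoc[OF ev B(1) v, symmetric])
  also have "\<dots> = vec_mult_mat v (B * mat_eval A (p \<circ>\<^sub>p [:0, l:]))"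
    by (simp add: mat_eval_intertwine[OF A B])
  also have "\<dots> = vec_mult_mat (act q) (mat_eval A (p \<circ>\<^sub>p [:0, l:]))"
    unfolding vB[symmetric] by (rule vec_mult_mat_assoc[OF B(1) ev v])
  finally show ?thesis by (simp add: act_mult)
qed

text \<open>By \<open>act_intertwine\<close>, the value of $B$ on every vector $v\,p(A)$ is determined by $vB$.\<close>

lemma twisted_centralizer_eqI:
  assumes "B \<in> twisted_centralizer A l" "B' \<in> twisted_centralizer A l"
    and eq: "vec_mult_mat v B = vec_mult_mat v B'"
  shows "B = B'"
proof -
  have car: "B \<in> carrier_mat n n" "B' \<in> carrier_mat n n"
    using assms mem_twisted_centralizer_iff[OF A] by auto
  obtain q where q: "act q = vec_mult_mat v B"
    using surj_act vec_mult_mat_carrier[OF car(1)] by blast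
  show ?thesis
  proof (rule mat_eq_by_vec_mult_mat[OF car])
    fix u :: "'a vec" assume "u \<in> carrier_vec n"
    then obtain p where "act p = u" using surj_act by blast
    then show "vec_mult_mat u B = vec_mult_mat u B'"
      using act_intertwine[of B l q p] act_intertwine[of B' l q p] assms q by auto
  qed
qed

text \<open>Apply $B$ to $v\,c_A(A) = 0$.\<close>

lemma twisted_centralizer_imp_dvd:
  assumes B: "B \<in> twisted_centralizer A l" and vB: "vec_mult_mat v B = act q"
  shows "c dvd q * (c \<circ>\<^sub>p [:0, l:])"
proof -
  have car: "B \<in> carrier_mat n n" using B mem_twisted_centralizer_iff[OF A] by auto
  have "act ((c \<circ>\<^sub>p [:0, l:]) * q) = vec_mult_mat (0\<^sub>v n) B"
    using act_intertwine[OF assms, of c] act_eq_0_iff[of c] by simp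
  also have "\<dots> = 0\<^sub>v n" using car by (auto simp: vec_mult_mat_def)
  finally show ?thesis by (simp add: act_eq_0_iff mult.commute)
qed

text \<open>The row vectors $v\,p(A)$ exhaust $F^n$, and $v\,p(A) \mapsto v\,q(A)\,p(\lambda A)$ is well
  defined by the divisibility assumption. The matrix $B$ of this map is read off from
  representatives $r_i$ of the unit vectors; well-definedness shows that $B$ represents the map on
  all of $F^n$ and not only on the chosen representatives.\<close>

lemma ex_twisted_centralizer:
  assumes dvd: "c dvd q * (c \<circ>\<^sub>p [:0, l:])"
  shows "\<exists>B \<in> twisted_centralizer A l. vec_mult_mat v B = act q"
proof -
  have "\<forall>i. \<exists>r. i < n \<longrightarrow> act r = unit_vec n i"
    using surj_act unit_vec_carrier by blast
  then obtain r where r: "\<And>i. i < n \<Longrightarrow> act (r i) = unit_vec n i" by metis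
  define B where "B = mat n n (\<lambda>(i, j). act (q * (r i \<circ>\<^sub>p [:0, l:])) $ j)"
  have B: "B \<in> carrier_mat n n" by (simp add: B_def)
  have act_B: "vec_mult_mat (act p) B = act (q * (p \<circ>\<^sub>p [:0, l:]))" for p
  proof -
    \<comment> \<open>The combination of the representatives that has the same image as $p$; on it $B$ has the
      right value by linearity.\<close>
    define s where "s = (\<Sum>i<n. Polynomial.smult (act p $ i) (r i))"
    have "act s = act p"
    proof (rule eq_vecI)
      fix j assume "j < dim_vec (act p)"
      then have j: "j < n" by simp
      then have "act s $ j = (\<Sum>i<n. act p $ i * unit_vec n i $ j)"
        by (simp add: s_def act_sum_index act_smult r)
      also have "\<dots> = (\<Sum>i<n. if i = j then act p $ i else 0)"
        using j by (intro sum.cong) auto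
      finally show "act s $ j = act p $ j" using j by simp
    qed simp
    then obtain k where "p - s = c * k" by (metis act_eq_iff dvdE)
    then have "p = s + c * k" by (simp add: algebra_simps)
    then have "q * (p \<circ>\<^sub>p [:0, l:]) - q * (s \<circ>\<^sub>p [:0, l:]) = q * (c \<circ>\<^sub>p [:0, l:]) * (k \<circ>\<^sub>p [:0, l:])"
      by (simp add: pcompose_add pcompose_mult algebra_simps)
    then have "act (q * (p \<circ>\<^sub>p [:0, l:])) = act (q * (s \<circ>\<^sub>p [:0, l:]))"
      using dvd by (simp add: act_eq_iff)
    also have "\<dots> = vec_mult_mat (act p) B"
    proof (rule eq_vecI)
      fix j assume "j < dim_vec (vec_mult_mat (act p) B)"
      then have j: "j < n" using B by (simp add: vec_mult_mat_def)
      have "q * (s \<circ>\<^sub>p [:0, l:])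
          = (\<Sum>i<n. Polynomial.smult (act p $ i) (q * (r i \<circ>\<^sub>p [:0, l:])))"
        by (simp add: s_def pcompose_sum pcompose_smult sum_distrib_left)
      moreover have "vec_mult_mat (act p) B $ j
          = (\<Sum>i<n. act p $ i * act (q * (r i \<circ>\<^sub>p [:0, l:])) $ j)"
        unfolding vec_mult_mat_index[OF B act_carrier j] using j by (simp add: B_def)
      ultimately show "act (q * (s \<circ>\<^sub>p [:0, l:])) $ j = vec_mult_mat (act p) B $ j"
        using j by (simp add: act_sum_index act_smult)
    qed (use B in \<open>simp add: vec_mult_mat_def\<close>)
    finally show ?thesis by simp
  qed
  have "A * B = l \<cdot>\<^sub>m (B * A)"
  proof (rule mat_eq_by_vec_mult_mat)
    fix u :: "'a vec" assume u: "u \<in> carrier_vec n"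
    then obtain p where p: "act p = u" using surj_act by blast
    have "vec_mult_mat u (A * B) = vec_mult_mat (act ([:0, 1:] * p)) B"
      using vec_mult_mat_assoc[OF A B u] by (simp only: act_X_mult p)
    also have "\<dots> = act (Polynomial.smult l ([:0, 1:] * (q * (p \<circ>\<^sub>p [:0, l:]))))"
      unfolding act_B by (rule arg_cong[of _ _ act]) (simp add: pcompose_pCons)
    also have "\<dots> = l \<cdot>\<^sub>v vec_mult_mat (vec_mult_mat u B) A"
      unfolding act_smult act_X_mult act_B[symmetric] p ..
    also have "\<dots> = vec_mult_mat u (l \<cdot>\<^sub>m (B * A))"
      using vec_mult_mat_assoc[OF B A u] vec_mult_mat_smult[OF mult_carrier_mat[OF B A] u] by simp
    finally show "vec_mult_mat u (A * B) = vec_mult_mat u (l \<cdot>\<^sub>m (B * A))" .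
  qed (use A B in auto)
  then have "B \<in> twisted_centralizer A l" using B by (simp add: mem_twisted_centralizer_iff[OF A])
  moreover have "vec_mult_mat v B = act q" using act_B[of 1] by (simp add: act_1 pcompose_1)
  ultimately show ?thesis by blast
qed

text \<open>With $h = c_A/g$, the vectors $vB$ for $B$ in the twisted centralizer are the $v\,q(A)$ with
  $h \mid q$. Modulo $c_A = hg$ such a $q$ is $h$ times a unique polynomial of degree below
  $d = \deg g$, whose $d$ coefficients are coordinates for $B$.\<close>

lemma dim_twisted_centralizer:
  assumes g: "g = poly_gcd c (c \<circ>\<^sub>p [:0, l:])"
  shows "vectorspace.dim class_ring (twisted_centralizer_space A l) = degree g"
proof -
  define d where "d = degree g"
  have c0: "c \<noteq> 0" using degree_monic_char_poly[OF A] by auto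
  have "g dvd c" using is_normed_gcd_poly_gcd[of c "c \<circ>\<^sub>p [:0, l:]"] by (simp add: g is_normed_gcd_def)
  then obtain h where c: "c = h * g" by (metis dvdE mult.commute)
  then have h0: "h \<noteq> 0" and g0: "g \<noteq> 0" using c0 by auto
  have dvd_iff: "c dvd q * (c \<circ>\<^sub>p [:0, l:]) \<longleftrightarrow> h dvd q" for q
  proof -
    have "c dvd q * (c \<circ>\<^sub>p [:0, l:]) \<longleftrightarrow> c dvd q * g"
      unfolding g by (rule dvd_mult_iff_dvd_mult_poly_gcd)
    also have "\<dots> \<longleftrightarrow> h dvd q" unfolding c using g0 by simp
    finally show ?thesis .
  qed
  define P where "P = (\<lambda>x :: 'a vec. \<Sum>i<d. Polynomial.monom (x $ i) i)"
  have coeff_P: "coeff (P x) i = (if i < d then x $ i else 0)" for x i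
    by (auto simp: P_def coeff_sum)
  have P_add: "P (x + y) = P x + P y" if "x \<in> carrier_vec d" "y \<in> carrier_vec d" for x y
    using that by (auto simp: poly_eq_iff coeff_P)
  have P_smult: "P (a \<cdot>\<^sub>v x) = Polynomial.smult a (P x)" if "x \<in> carrier_vec d" for a x
    using that by (auto simp: poly_eq_iff coeff_P)
  have "\<exists>B. B \<in> twisted_centralizer A l \<and> vec_mult_mat v B = act (h * P x)" for x
    using ex_twisted_centralizer[of "h * P x" l] dvd_iff[of "h * P x"] by auto
  then obtain T where T: "\<And>x. T x \<in> twisted_centralizer A l"
    and vT: "\<And>x. vec_mult_mat v (T x) = act (h * P x)" by metis
  have T_car: "T x \<in> carrier_mat n n" for x using T mem_twisted_centralizer_iff[OF A] by blast
  let ?W = "twisted_centralizer_space A l"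
  have W: "carrier ?W = twisted_centralizer A l" "add ?W = (+)" "module.smult ?W = (\<cdot>\<^sub>m)"
    by (simp_all add: twisted_centralizer_space_def module_mat_simps)
  interpret W: vectorspace class_ring ?W by (rule vectorspace_twisted_centralizer[OF A])
  interpret V: vec_space "TYPE('a)" d .
  have T_add: "T (x + y) = T x + T y" if "x \<in> carrier_vec d" "y \<in> carrier_vec d" for x y
  proof (rule twisted_centralizer_eqI)
    show "T x + T y \<in> twisted_centralizer A l" using W.a_closed[of "T x" "T y"] T by (simp add: W)
    show "vec_mult_mat v (T (x + y)) = vec_mult_mat v (T x + T y)"
      by (simp add: vT P_add[OF that] vec_mult_mat_add[OF T_car T_car v] distrib_left act_add)
  qed (rule T)
  have T_smult: "T (a \<cdot>\<^sub>v x) = a \<cdot>\<^sub>m T x" if "x \<in> carrier_vec d" for a x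
  proof (rule twisted_centralizer_eqI)
    show "a \<cdot>\<^sub>m T x \<in> twisted_centralizer A l" using W.smult_closed[of a "T x"] T by (simp add: W)
    show "vec_mult_mat v (T (a \<cdot>\<^sub>v x)) = vec_mult_mat v (a \<cdot>\<^sub>m T x)"
      by (simp add: vT P_smult[OF that] vec_mult_mat_smult[OF T_car v] act_smult)
  qed (rule T)
  interpret T: linear_map class_ring V.V ?W T
  proof unfold_locales
    show "T \<in> module_hom class_ring V.V ?W"
      using T T_add T_smult by (auto simp: module_hom_def W module_vec_simps)
  qed
  have "inj_on T (carrier_vec d)"
  proof
    fix x y assume xy: "x \<in> carrier_vec d" "y \<in> carrier_vec d" "T x = T y"
    then have "act (h * P x) = act (h * P y)" using vT by metis
    then have "h * g dvd h * (P x - P y)" by (simp add: act_eq_iff c right_diff_distrib)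
    then have dvd: "g dvd P x - P y" using h0 by simp
    have "P x - P y = 0"
    proof (rule ccontr)
      assume nz: "P x - P y \<noteq> 0"
      then have "d \<le> degree (P x - P y)" using dvd_imp_degree_le[OF dvd] by (simp add: d_def)
      then have "coeff (P x - P y) (degree (P x - P y)) = 0" by (simp add: coeff_P)
      then show False using nz leading_coeff_0_iff by blast
    qed
    then have "coeff (P x) i = coeff (P y) i" for i by simp
    then have "x $ i = y $ i" if "i < d" for i using that coeff_P by metis
    then show "x = y" using xy by auto
  qed
  moreover have "T ` carrier_vec d = twisted_centralizer A l"
  proof
    show "twisted_centralizer A l \<subseteq> T ` carrier_vec d"
    proof
      fix B assume B: "B \<in> twisted_centralizer A l"
      then have "vec_mult_mat v B \<in> carrier_vec n"
        using vec_mult_mat_carrier mem_twisted_centralizer_iff[OF A] by blast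
      then obtain q where q: "act q = vec_mult_mat v B" using surj_act by blast
      then have "h dvd q" using twisted_centralizer_imp_dvd[OF B] dvd_iff by simp
      then obtain r where r: "q = h * r" by (elim dvdE)
      define x where "x = vec d (coeff (r mod g))"
      have "coeff (r mod g) i = 0" if "i \<ge> d" for i
        using that degree_mod_less[OF g0, of r] by (auto simp: d_def intro: coeff_eq_0)
      then have "P x = r mod g" by (auto simp: poly_eq_iff coeff_P x_def)
      then have "q - h * P x = h * (r - r mod g)" by (simp add: r right_diff_distrib)
      also have "\<dots> = c * (r div g)" unfolding minus_mod_eq_mult_div c by (simp add: mult.assoc)
      finally have "q - h * P x = c * (r div g)" .
      then have "act q = act (h * P x)" by (simp add: act_eq_iff)
      then have "B = T x" using twisted_centralizer_eqI[OF B T] q vT by simp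
      then show "B \<in> T ` carrier_vec d" by (simp add: x_def)
    qed
  qed (use T in auto)
  ultimately have "V.dim = vectorspace.dim class_ring ?W"
    by (intro T.dim_eq) (auto simp: W module_vec_simps)
  then show ?thesis using V.dim_is_n by (simp add: d_def)
qed

end

section \<open>The dimension formula\<close>

lemma poly_gcd_eqI:
  assumes "\<And>e. e dvd p \<and> e dvd q \<longleftrightarrow> e dvd p' \<and> e dvd q'"
  shows "poly_gcd p q = poly_gcd p' (q' :: 'a :: field poly)"
proof -
  have "is_normed_gcd p q = is_normed_gcd p' q'"
    using assms by (auto simp: is_normed_gcd_def fun_eq_iff)
  then show ?thesis by (simp add: poly_gcd_def)
qed

lemma pcompose_scale_scale:
  fixes l :: "'a :: field"
  assumes "l \<noteq> 0"
  shows "(p \<circ>\<^sub>p [:0, inverse l:]) \<circ>\<^sub>p [:0, l:] = p"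
  using assms by (simp add: pcompose_assoc[symmetric] pcompose_pCons pcompose_idR)

lemma pcompose_dvd_pcompose:
  fixes p q r :: "'a :: comm_ring_1 poly"
  shows "p dvd q \<Longrightarrow> p \<circ>\<^sub>p r dvd q \<circ>\<^sub>p r"
  by (auto elim!: dvdE simp: pcompose_mult)

text \<open>An inequality suffices: applied to $\lambda$ and to $\lambda^{-1}$ it gives equality.\<close>

lemma degree_poly_gcd_scale_le:
  fixes p q :: "'a :: field poly"
  assumes l: "l \<noteq> 0" and p: "p \<noteq> 0"
  shows "degree (poly_gcd p q) \<le> degree (poly_gcd (p \<circ>\<^sub>p [:0, l:]) (q \<circ>\<^sub>p [:0, l:]))"
proof -
  let ?g = "poly_gcd p q" and ?g' = "poly_gcd (p \<circ>\<^sub>p [:0, l:]) (q \<circ>\<^sub>p [:0, l:])"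
  have "?g \<circ>\<^sub>p [:0, l:] dvd ?g'"
    using is_normed_gcd_poly_gcd[of p q]
      is_normed_gcd_poly_gcd[of "p \<circ>\<^sub>p [:0, l:]" "q \<circ>\<^sub>p [:0, l:]"]
    by (simp add: is_normed_gcd_def pcompose_dvd_pcompose)
  moreover have "?g' \<noteq> 0"
    using is_normed_gcd_poly_gcd[of "p \<circ>\<^sub>p [:0, l:]" "q \<circ>\<^sub>p [:0, l:]"] l p
    by (auto simp: is_normed_gcd_def pcompose_eq_0_iff)
  ultimately have "degree (?g \<circ>\<^sub>p [:0, l:]) \<le> degree ?g'" by (rule dvd_imp_degree_le)
  then show ?thesis using l by (simp add: degree_pcompose)
qed

theorem theorem4p2:
  fixes A :: "'a :: field mat" and l :: 'a and n :: nat
  assumes "n \<ge> 1"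
    and "l \<noteq> 0"
    and "A \<in> carrier_mat n n"
    and "cyclic_mat A"
  shows "vectorspace.dim class_ring (twisted_centralizer_space A l)
           = degree (poly_gcd (char_poly A) (twisted_char_poly A l))
         \<and> degree (poly_gcd (char_poly A) (twisted_char_poly A l))
           = degree (poly_gcd (twisted_char_poly A (inverse l)) (char_poly A))"
proof
  note l = assms(2) and A = assms(3)
  let ?c = "char_poly A"
  let ?up = "?c \<circ>\<^sub>p [:0, l:]" and ?down = "?c \<circ>\<^sub>p [:0, inverse l:]"
  have c0: "?c \<noteq> 0" using degree_monic_char_poly[OF A] by auto
  have up: "poly_gcd ?c (twisted_char_poly A l) = poly_gcd ?c ?up"
    using l by (intro poly_gcd_eqI) (simp add: twisted_char_poly_def dvd_smult_iff)
  have down: "poly_gcd (twisted_char_poly A (inverse l)) ?c = poly_gcd ?down ?c"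
    using l by (intro poly_gcd_eqI) (simp add: twisted_char_poly_def dvd_smult_iff)
  obtain v where "v \<in> carrier_vec n"
    "\<And>q. \<forall>k\<ge>n. coeff q k = 0 \<Longrightarrow> vec_mult_mat v (mat_eval A q) = 0\<^sub>v n \<Longrightarrow> q = 0"
    "\<And>w. w \<in> carrier_vec n \<Longrightarrow> \<exists>q. vec_mult_mat v (mat_eval A q) = w"
    using cyclic_matE[OF A assms(4)] by blast
  then interpret cyclic_vector A n v using A by unfold_locales auto
  show "vectorspace.dim class_ring (twisted_centralizer_space A l)
      = degree (poly_gcd ?c (twisted_char_poly A l))"
    unfolding up by (rule dim_twisted_centralizer) simp
  have "?down \<circ>\<^sub>p [:0, l:] = ?c" "?up \<circ>\<^sub>p [:0, inverse l:] = ?c"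
    using pcompose_scale_scale[of l ?c] pcompose_scale_scale[of "inverse l" ?c] l by simp_all
  then have "degree (poly_gcd ?c ?up) = degree (poly_gcd ?down ?c)"
    using degree_poly_gcd_scale_le[of "inverse l" ?c ?up] degree_poly_gcd_scale_le[of l ?down ?c]
      l c0 by (auto simp: pcompose_eq_0_iff)
  then show "degree (poly_gcd ?c (twisted_char_poly A l))
      = degree (poly_gcd (twisted_char_poly A (inverse l)) ?c)"
    unfolding up down .
qed

end
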